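(* Let $\mu,\nu$ be probability measures on $\mathbb{R}^d$ with compact supports and $\mu\ll\mathcal{L}^d$. Let $c:\mathbb{R}^d\times\mathbb{R}^d\to\mathbb{R}^+$ be continuous and satisfy: (i) for every $x$ there is a unique $y$ with $c(x,y)=0$, and for every $y$, $\inf_x c(x,y)=0$; (ii) for every $y$, $c(\cdot,y)$ is strictly quasiconvex; (iii) for all $\lambda>0$ and $y$, the set $\{z:c(z,y)\le\lambda\}$ has $C^1$ boundary; (iv) for all $x,y,\tilde y$ and $\lambda>0$: if $c(x,y)=c(x,\tilde y)=\lambda$ and $n_{c(\cdot,y)}(x)=n_{c(\cdot,\tilde y)}(x)$ then $y=\tilde y$. Assume $\nu(\{y_0\})>0$ for some $y_0\in\mathbb{R}^d$. Let $T$ and $\tilde T$ be optimal transport maps (Borel maps pushing $\mu$ to $\nu$, optimal for the problem $\min_{\gamma\in\Pi(\mu,\nu)}\gamma\text{-}\operatorname{ess\,sup}c$) corresponding respectively to $\infty$-$c$-cyclically monotone transport plans $\gamma=(\mathrm{Id}\times T)_\sharp\mu$ and $\tilde\gamma=(\mathrm{Id}\times\tilde T)_\sharp\mu$. Then $$\mu\big(T^{-1}(\{y_0\})\setminus\tilde T^{-1}(\{y_0\})\big)=0.$$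
   Context: $\Pi(\mu,\nu)$ is the set of Borel probability measures on $\mathbb{R}^d\times\mathbb{R}^d$ with marginals $\mu,\nu$. Strict quasiconvexity of $c(\cdot,y)$ means $c((1-t)x+t\bar x,y)<\max\{c(x,y),c(\bar x,y)\}$ for all $t\in(0,1)$ and $x\neq\bar x$. For $c(x,y)=\lambda>0$, $n_{c(\cdot,y)}(x)$ is the unit outer normal at $x$ to $\{z:c(z,y)\le\lambda\}$. A set $\Gamma\subset\mathbb{R}^d\times\mathbb{R}^d$ is $\infty$-$c$-cyclically monotone if for every finite family $\{(x_i,y_i)\}_{i=1}^k\subset\Gamma$ and every permutation $\sigma$ of $\{1,\dots,k\}$, $\max_i c(x_i,y_i)\le\max_i c(x_i,y_{\sigma(i)})$; a plan is $\infty$-$c$-cyclically monotone if it is concentrated on such a set. *)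

theory Defs
  imports "HOL-Probability.Probability"
begin

definition msupport :: "'a::metric_space measure \<Rightarrow> 'a set" where
  "msupport M = {x. \<forall>e>0. emeasure M (ball x e) \<noteq> 0}"

definition couplings :: "'a::euclidean_space measure \<Rightarrow> 'a measure \<Rightarrow> ('a \<times> 'a) measure set" where
  "couplings \<mu> \<nu> = {\<gamma>. prob_space \<gamma> \<and> sets \<gamma> = sets (borel :: ('a \<times> 'a) measure) \<and>
       distr \<gamma> borel fst = \<mu> \<and> distr \<gamma> borel snd = \<nu>}"

definition linf_optimal ::
  "('a::euclidean_space \<Rightarrow> 'a \<Rightarrow> real) \<Rightarrow> 'a measure \<Rightarrow> 'a measure \<Rightarrow> ('a \<times> 'a) measure \<Rightarrow> bool" where
  "linf_optimal c \<mu> \<nu> \<gamma> \<longleftrightarrow> \<gamma> \<in> couplings \<mu> \<nu> \<and>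
     (\<forall>\<gamma>'\<in>couplings \<mu> \<nu>. esssup \<gamma> (\<lambda>(x,y). ereal (c x y)) \<le> esssup \<gamma>' (\<lambda>(x,y). ereal (c x y)))"

definition inf_c_cyclically_monotone :: "('a \<Rightarrow> 'a \<Rightarrow> real) \<Rightarrow> ('a \<times> 'a) set \<Rightarrow> bool" where
  "inf_c_cyclically_monotone c \<Gamma> \<longleftrightarrow>
     (\<forall>k::nat. \<forall>x y \<sigma>. k \<ge> 1 \<longrightarrow> (\<forall>i<k. (x i, y i) \<in> \<Gamma>) \<longrightarrow> \<sigma> permutes {..<k} \<longrightarrow>
        Max ((\<lambda>i. c (x i) (y i)) ` {..<k}) \<le> Max ((\<lambda>i. c (x i) (y (\<sigma> i))) ` {..<k}))"

definition inf_c_cm_plan :: "('a \<Rightarrow> 'a \<Rightarrow> real) \<Rightarrow> ('a \<times> 'a) measure \<Rightarrow> bool" where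
  "inf_c_cm_plan c \<gamma> \<longleftrightarrow> (\<exists>\<Gamma>. inf_c_cyclically_monotone c \<Gamma> \<and> (AE p in \<gamma>. p \<in> \<Gamma>))"

definition strictly_quasiconvex :: "('a::real_vector \<Rightarrow> real) \<Rightarrow> bool" where
  "strictly_quasiconvex f \<longleftrightarrow>
     (\<forall>x x' t. x \<noteq> x' \<longrightarrow> 0 < t \<longrightarrow> t < 1 \<longrightarrow>
        f ((1 - t) *\<^sub>R x + t *\<^sub>R x') < max (f x) (f x'))"

definition C1_defining_fun :: "'a::euclidean_space set \<Rightarrow> 'a \<Rightarrow> 'a set \<Rightarrow> ('a \<Rightarrow> real) \<Rightarrow> ('a \<Rightarrow> 'a) \<Rightarrow> bool" where
  "C1_defining_fun S p U \<rho> g \<longleftrightarrow> open U \<and> p \<in> U \<and>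
     (\<forall>z\<in>U. (\<rho> has_derivative (\<lambda>h. g z \<bullet> h)) (at z)) \<and> continuous_on U g \<and>
     (\<forall>z\<in>U. g z \<noteq> 0) \<and> S \<inter> U = {z\<in>U. \<rho> z \<le> 0}"

definition C1_boundary :: "'a::euclidean_space set \<Rightarrow> bool" where
  "C1_boundary S \<longleftrightarrow> (\<forall>p\<in>frontier S. \<exists>U \<rho> g. C1_defining_fun S p U \<rho> g)"

definition outer_normal :: "'a::euclidean_space set \<Rightarrow> 'a \<Rightarrow> 'a \<Rightarrow> bool" where
  "outer_normal S p n \<longleftrightarrow> (\<exists>U \<rho> g. C1_defining_fun S p U \<rho> g \<and> n = g p /\<^sub>R norm (g p))"

end

theory Submission
  imports Defs
begin

text \<open>Let \<open>D = {T \<noteq> T'}\<close> and \<open>x \<in> D\<close>. By twistedness the normals at \<open>x\<close> of the sublevel sets for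
  \<open>T x\<close> and \<open>T' x\<close> differ whenever the two costs agree, so there is an open cone of displacements that
  moves outwards for the former and inwards for the latter. For almost every \<open>x\<close> this cone contains
  points \<open>a\<close> arbitrarily close to \<open>x\<close> with \<open>T a\<close> close to \<open>T x\<close>, and the detour \<open>x \<rightarrow> T a\<close>,
  \<open>a \<rightarrow> T' x\<close> costs strictly less than the maximum of \<open>c x (T x)\<close>, \<open>c x (T' x)\<close> and \<open>c a (T a)\<close>.
  In a cycle \<open>T' x\<^sub>j \<approx> T x\<^sub>j\<^sub>+\<^sub>1\<close>, inserting such detours into the monotonicity inequality for \<open>T\<close> gives
  \<open>max\<^sub>j c x\<^sub>j (T x\<^sub>j) < max\<^sub>j c x\<^sub>j (T' x\<^sub>j)\<close>; exchanging the roles of \<open>T\<close> and \<open>T'\<close> gives the reverse, a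
  contradiction. Approximate cycles suffice as long as the gain is bounded below along the cycle. Since
  the gain exceeds some \<open>1 / (n + 1)\<close> on a set \<open>K \<subseteq> D\<close> with \<open>\<mu> (D - K)\<close> smaller than the mass that
  only \<open>T\<close> sends to the atom \<open>y0\<close>, conservation of mass yields a cycle through \<open>y0\<close> inside \<open>K\<close>.\<close>

subsection \<open>Strictly quasiconvex functions and normals to their sublevel sets\<close>

lemma strictly_quasiconvexD_between:
  fixes f :: "'a::real_vector \<Rightarrow> real"
  assumes "strictly_quasiconvex f" "w \<noteq> 0" "a > 0" "b > 0"
  shows "f x < max (f (x - a *\<^sub>R w)) (f (x + b *\<^sub>R w))"
proof -
  \<comment> \<open>This weight satisfies \<open>t * b = (1 - t) * a\<close>, so the two
    displacements along \<open>w\<close> cancel and the convex combination of the endpoints is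
    \<open>x\<close>.\<close>
  define t where "t = a / (a + b)"
  have t: "0 < t" "t < 1" and eq: "t * b = (1 - t) * a"
    using assms by (auto simp: t_def field_simps)
  have ne: "x - a *\<^sub>R w \<noteq> x + b *\<^sub>R w"
  proof
    assume "x - a *\<^sub>R w = x + b *\<^sub>R w"
    then have "(a + b) *\<^sub>R w = 0"
      by (simp add: algebra_simps)
    then show False
      using assms by auto
  qed
  have "(1 - t) *\<^sub>R (x - a *\<^sub>R w) + t *\<^sub>R (x + b *\<^sub>R w)
        = ((1 - t) + t) *\<^sub>R x + (t * b - (1 - t) * a) *\<^sub>R w"
    unfolding scaleR_right_diff_distrib scaleR_right_distrib scaleR_left_distrib
      scaleR_left_diff_distrib scaleR_scaleR by simp
  also have "\<dots> = x"
    using eq by simp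
  finally show ?thesis
    using assms(1) ne t unfolding strictly_quasiconvex_def by metis
qed

text \<open>\<open>x\<close> lies strictly between the two displaced points; since the value behind
  it is already smaller than \<open>f x\<close>, the maximum has to come from the point
  ahead.\<close>

lemma strictly_quasiconvex_increasing_along:
  fixes f :: "'a::real_vector \<Rightarrow> real"
  assumes "strictly_quasiconvex f" "f (x - s *\<^sub>R w) < f x" "s > 0" "t > 0"
  shows "f x < f (x + t *\<^sub>R w)"
proof -
  have "w \<noteq> 0" using assms(2) by auto
  from strictly_quasiconvexD_between[OF assms(1) this assms(3,4), of x] assms(2)
  show ?thesis by auto
qed

lemma strictly_quasiconvex_decreasing_along:
  fixes f :: "'a::real_vector \<Rightarrow> real"
  assumes "strictly_quasiconvex f" "f (x + s *\<^sub>R w) < f x" "0 < t" "t \<le> s"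
  shows "f (x + t *\<^sub>R w) < f x"
proof (cases "t = s")
  case False
  have "w \<noteq> 0" using assms(2) by auto
  have "f (x + t *\<^sub>R w) < max (f (x + t *\<^sub>R w - t *\<^sub>R w)) (f (x + t *\<^sub>R w + (s - t) *\<^sub>R w))"
    by (rule strictly_quasiconvexD_between[OF assms(1) \<open>w \<noteq> 0\<close>]) (use False assms in auto)
  also have "x + t *\<^sub>R w + (s - t) *\<^sub>R w = x + s *\<^sub>R w"
    by (simp add: algebra_simps)
  finally show ?thesis using assms(2) by auto
qed (use assms in simp)

text \<open>A ball around \<open>x\<close> inside the sublevel set would reach past \<open>x\<close>
  on the ray from \<open>z\<close> through \<open>x\<close>, where \<open>f\<close> exceeds
  \<open>f x\<close>.\<close>

lemma frontier_sublevel_strictly_quasiconvex: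
  fixes f :: "'a::euclidean_space \<Rightarrow> real"
  assumes qc: "strictly_quasiconvex f" and lt: "f z < f x"
  shows "x \<in> frontier {u. f u \<le> f x}"
proof -
  have "x \<notin> interior {u. f u \<le> f x}"
  proof
    assume "x \<in> interior {u. f u \<le> f x}"
    then obtain e where e: "e > 0" "ball x e \<subseteq> {u. f u \<le> f x}"
      unfolding mem_interior by blast
    define t where "t = e / (2 * norm (x - z))"
    have nz: "x \<noteq> z" using lt by auto
    then have t: "t > 0" using e by (simp add: t_def)
    have "f x < f (x + t *\<^sub>R (x - z))"
      by (rule strictly_quasiconvex_increasing_along[OF qc, of x 1]) (use lt t in auto)
    moreover have "x + t *\<^sub>R (x - z) \<in> ball x e"
      using nz e by (simp add: dist_norm t_def)
    ultimately show False using e by force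
  qed
  moreover have "x \<in> closure {u. f u \<le> f x}"
    by (intro subsetD[OF closure_subset]) simp
  ultimately show ?thesis by (simp add: frontier_def)
qed

text \<open>Along \<open>u\<close> the defining function decreases to first order, so a short step
  from \<open>x\<close> stays in the sublevel set.\<close>

lemma outer_normal_descent:
  fixes f :: "'a::euclidean_space \<Rightarrow> real"
  assumes qc: "strictly_quasiconvex f"
    and n: "outer_normal {u. f u \<le> f x} x n" and u: "n \<bullet> u < 0"
  shows "\<exists>s>0. f (x + s *\<^sub>R u) < f x"
proof -
  obtain U \<rho> g where d: "C1_defining_fun {u. f u \<le> f x} x U \<rho> g" and ng: "n = g x /\<^sub>R norm (g x)"
    using n unfolding outer_normal_def by blast
  have op: "open U" "x \<in> U" and S: "{u. f u \<le> f x} \<inter> U = {z\<in>U. \<rho> z \<le> 0}"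
    and der: "(\<rho> has_derivative (\<lambda>h. g x \<bullet> h)) (at x)" and g0: "g x \<noteq> 0"
    using d unfolding C1_defining_fun_def by auto
  have gu: "g x \<bullet> u < 0"
    using u g0 unfolding ng by (simp add: mult_less_0_iff field_simps)
  have "((\<lambda>s. \<rho> (x + s *\<^sub>R u)) has_derivative (\<lambda>s. g x \<bullet> (s *\<^sub>R u))) (at 0)"
    by (rule has_derivative_compose[of "\<lambda>s. x + s *\<^sub>R u" "\<lambda>s. s *\<^sub>R u" 0 UNIV \<rho>])
       (use der in \<open>auto intro!: derivative_eq_intros\<close>)
  then have "((\<lambda>s. \<rho> (x + s *\<^sub>R u)) has_real_derivative (g x \<bullet> u)) (at 0)"
    unfolding has_field_derivative_def by (rule has_derivative_eq_rhs) auto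
  from DERIV_neg_dec_right[OF this gu] obtain d where d: "d > 0"
    and dec: "\<And>h. 0 < h \<Longrightarrow> h < d \<Longrightarrow> \<rho> (x + h *\<^sub>R u) < \<rho> x"
    by auto
  have "((\<lambda>s. x + s *\<^sub>R u) \<longlongrightarrow> x + 0 *\<^sub>R u) (at_right 0)"
    by (intro tendsto_intros)
  then have "eventually (\<lambda>s. x + s *\<^sub>R u \<in> U) (at_right 0)"
    using op by (auto intro: topological_tendstoD)
  moreover have "eventually (\<lambda>s::real. 0 < s \<and> s < d) (at_right 0)"
    using eventually_at_right_real[OF d] by (simp add: greaterThanLessThan_def)
  ultimately have "eventually (\<lambda>s. x + s *\<^sub>R u \<in> U \<and> 0 < s \<and> s < d) (at_right 0)"
    by eventually_elim auto
  then obtain s where s: "x + s *\<^sub>R u \<in> U" "0 < s" "s < d"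
    using eventually_happens'[OF trivial_limit_at_right_real] by blast
  have "\<rho> x \<le> 0" using op S by blast
  with dec[of s] s have "x + s *\<^sub>R u \<in> {z\<in>U. \<rho> z \<le> 0}" by auto
  then have le: "f (x + s *\<^sub>R u) \<le> f x" unfolding S[symmetric] by simp
  \<comment> \<open>The step \<open>s\<close> gives only a weak inequality. Halving it yields a
    point strictly between two points of the sublevel set, where strict quasiconvexity makes the
    inequality strict.\<close>
  have u0: "u \<noteq> 0" using u by auto
  have "f (x + (s/2) *\<^sub>R u) < max (f (x + (s/2) *\<^sub>R u - (s/2) *\<^sub>R u)) (f (x + (s/2) *\<^sub>R u + (s/2) *\<^sub>R u))"
    by (rule strictly_quasiconvexD_between[OF qc u0]) (use s in auto)
  also have "x + (s/2) *\<^sub>R u + (s/2) *\<^sub>R u = x + s *\<^sub>R u"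
    by (simp add: scaleR_left_distrib[symmetric] add.assoc)
  finally show ?thesis using le s by (intro exI[of _ "s/2"]) auto
qed

lemma outer_normal_exists:
  fixes f :: "'a::euclidean_space \<Rightarrow> real"
  assumes qc: "strictly_quasiconvex f" and C1: "C1_boundary {u. f u \<le> f x}" and lt: "f z < f x"
  obtains n where "outer_normal {u. f u \<le> f x} x n" "norm n = 1"
proof -
  obtain U \<rho> g where d: "C1_defining_fun {u. f u \<le> f x} x U \<rho> g"
    using C1 frontier_sublevel_strictly_quasiconvex[OF qc lt] unfolding C1_boundary_def by blast
  then have "g x \<noteq> 0" unfolding C1_defining_fun_def by blast
  with d show ?thesis
    by (intro that[of "g x /\<^sub>R norm (g x)"]) (auto simp: outer_normal_def)
qed

lemma continuous_less_on_ball: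
  fixes f :: "'a::metric_space \<Rightarrow> real"
  assumes "continuous_on UNIV f" "f a < b"
  obtains e where "e > 0" "\<And>x. dist a x < e \<Longrightarrow> f x < b"
proof -
  have "open {x. f x < b}"
    using assms(1) by (intro open_Collect_less continuous_intros)
  then obtain e where "e > 0" "ball a e \<subseteq> {x. f x < b}"
    using assms(2) unfolding open_contains_ball by blast
  then show ?thesis by (intro that[of e]) auto
qed

subsection \<open>Points of approximate continuity in cones\<close>

text \<open>Infinitely many disjoint translates of a bounded set fit into a bounded set.\<close>

lemma null_sets_lborel_disjoint_translates:
  fixes N :: "'a::euclidean_space set"
  assumes N: "N \<in> sets borel" and "t0 > 0"
    and disj: "\<And>x t. \<lbrakk>x \<in> N; 0 < t; t < t0\<rbrakk> \<Longrightarrow> x + t *\<^sub>R v \<notin> N"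
  shows "N \<in> null_sets lborel"
proof -
  have *: "N \<inter> ball 0 (real m) \<in> null_sets lborel" for m
  proof -
    \<comment> \<open>The shifts decrease strictly within \<open>(0, t0)\<close>, so any two differ
      by an amount to which \<open>disj\<close> applies.\<close>
    define s where "s i = t0 / (real i + 2)" for i :: nat
    define A where "A i = (+) (- s i *\<^sub>R v) -` (N \<inter> ball 0 (real m))" for i
    have s: "0 < s i" "s i < t0" for i
      using \<open>t0 > 0\<close> by (auto simp: s_def pos_divide_less_eq intro!: mult_strict_left_mono[of 1, simplified])
    have s_mono: "s j < s i" if "i < j" for i j
      using \<open>t0 > 0\<close> that by (auto simp: s_def intro!: divide_strict_left_mono)
    have meas: "A i \<in> sets borel" for i
    proof -
      have "(+) (- s i *\<^sub>R v) -` (N \<inter> ball 0 (real m)) \<inter> space borel \<in> sets borel"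
        by (rule measurable_sets[of _ borel borel]) (use N in auto)
      then show ?thesis by (simp add: A_def)
    qed
    have em: "emeasure lborel (A i) = emeasure lborel (N \<inter> ball 0 (real m))" for i
    proof -
      have "emeasure lborel (N \<inter> ball 0 (real m))
          = emeasure (distr lborel borel ((+) (- s i *\<^sub>R v))) (N \<inter> ball 0 (real m))"
        by (simp add: lborel_distr_plus)
      also have "\<dots> = emeasure lborel (A i)"
        using N by (subst emeasure_distr) (auto simp: A_def)
      finally show ?thesis ..
    qed
    have dis: "A i \<inter> A j = {}" if "i < j" for i j
    proof -
      have False if "p \<in> A i" "p \<in> A j" for p
      proof -
        have "p - s i *\<^sub>R v \<in> N" "p - s j *\<^sub>R v \<in> N"
          using that by (auto simp: A_def)
        moreover have "0 < s i - s j" "s i - s j < t0"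
          using s_mono[OF \<open>i < j\<close>] s[of i] s[of j] by auto
        ultimately show False
          using disj[of "p - s i *\<^sub>R v" "s i - s j"] by (simp add: algebra_simps)
      qed
      then show ?thesis by blast
    qed
    have "disjoint_family A"
      unfolding disjoint_family_on_def
    proof (intro ballI impI)
      fix i j :: nat assume "i \<noteq> j"
      then show "A i \<inter> A j = {}" using dis[of i j] dis[of j i] by (auto simp: neq_iff)
    qed
    then have "(\<Sum>i. emeasure lborel (A i)) = emeasure lborel (\<Union>i. A i)"
      using meas by (intro suminf_emeasure) auto
    also have "\<dots> \<le> emeasure lborel (ball (0::'a) (real m + t0 * norm v))"
    proof (rule emeasure_mono)
      show "(\<Union>i. A i) \<subseteq> ball 0 (real m + t0 * norm v)"
      proof
        fix p assume "p \<in> (\<Union>i. A i)"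
        then obtain i where "norm (p - s i *\<^sub>R v) < m" by (auto simp: A_def)
        moreover have "norm (s i *\<^sub>R v) \<le> t0 * norm v"
          using s[of i] by (simp add: mult_right_mono)
        ultimately show "p \<in> ball 0 (real m + t0 * norm v)"
          using norm_triangle_sub[of p "s i *\<^sub>R v"] by simp
      qed
    qed simp
    also have "\<dots> < \<infinity>" by (rule emeasure_lborel_ball_finite)
    finally have fin: "(\<Sum>i::nat. emeasure lborel (N \<inter> ball 0 (real m))) < \<infinity>"
      by (simp add: em)
    have "emeasure lborel (N \<inter> ball 0 (real m)) = 0"
    proof (rule ccontr)
      assume *: "emeasure lborel (N \<inter> ball 0 (real m)) \<noteq> 0"
      have "(\<Sum>i::nat. emeasure lborel (N \<inter> ball 0 (real m))) = \<infinity>"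
        using * nn_integral_count_space_nat[of "\<lambda>_. emeasure lborel (N \<inter> ball 0 (real m))"]
        by (simp add: ennreal_mult_top)
      with fin show False by simp
    qed
    then show ?thesis using N by (auto simp: null_sets_def)
  qed
  have "(\<Union>m. N \<inter> ball 0 (real m)) \<in> null_sets lborel"
    using * by blast
  also have "(\<Union>m. N \<inter> ball 0 (real m)) = N"
    by (auto intro: reals_Archimedean2)
  finally show ?thesis .
qed

text \<open>For a fixed direction \<open>q\<close>, a point of \<open>E\<close> whose cone misses
  \<open>E\<close> cannot be carried to another such point by a short shift along \<open>q\<close>,
  so these points form a null set. Countably many directions, apertures and lengths suffice.\<close>

lemma AE_lborel_meets_cones:
  fixes E :: "'a::euclidean_space set"
  assumes E: "E \<in> sets borel"
  shows "AE x in lborel. x \<in> E \<longrightarrow> (\<forall>v r t0. r > 0 \<longrightarrow> t0 > 0 \<longrightarrow>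
           (\<exists>u t. dist v u < r \<and> 0 < t \<and> t < t0 \<and> x + t *\<^sub>R u \<in> E))"
proof -
  obtain Q :: "'a set" where Q: "countable Q" "\<And>X. open X \<Longrightarrow> X \<noteq> {} \<Longrightarrow> \<exists>d\<in>Q. d \<in> X"
    by (rule countable_dense_setE) blast
  define e where "e k = 1 / real (Suc k)" for k
  have e: "e k > 0" for k by (simp add: e_def)
  define C where "C q m k = {x. \<exists>u t. dist q u < e m \<and> 0 < t \<and> t < e k \<and> x + t *\<^sub>R u \<in> E}"
    for q :: 'a and m k
  \<comment> \<open>Openness supplies the measurability of the exceptional sets: for a fixed landing
    point \<open>z\<close> and step \<open>t\<close>, the condition on \<open>x\<close> is
    open.\<close>
  have openC: "open (C q m k)" for q m k
  proof -
    have "C q m k = (\<Union>z\<in>E. \<Union>t\<in>{0<..<e k}. {x. dist q ((1 / t) *\<^sub>R (z - x)) < e m})"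
      (is "_ = ?R")
    proof (intro set_eqI iffI)
      fix x assume "x \<in> C q m k"
      then obtain u t where ut: "dist q u < e m" "0 < t" "t < e k" "x + t *\<^sub>R u \<in> E"
        by (auto simp: C_def)
      then have "(1 / t) *\<^sub>R (x + t *\<^sub>R u - x) = u" by simp
      with ut show "x \<in> ?R"
        by (intro UN_I[of "x + t *\<^sub>R u"] UN_I[of t]) auto
    next
      fix x assume "x \<in> ?R"
      then obtain z t where zt: "z \<in> E" "0 < t" "t < e k" "dist q ((1 / t) *\<^sub>R (z - x)) < e m"
        by auto
      then have "x + t *\<^sub>R ((1 / t) *\<^sub>R (z - x)) \<in> E" by simp
      with zt show "x \<in> C q m k" unfolding C_def by blast
    qed
    moreover have "open {x. dist q ((1 / t) *\<^sub>R (z - x)) < e m}" for t z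
      by (intro open_Collect_less continuous_intros)
    ultimately show ?thesis by (simp add: open_UN)
  qed
  have "E - C q m k \<in> null_sets lborel" for q m k
  proof (rule null_sets_lborel_disjoint_translates[of _ "e k" q])
    show "E - C q m k \<in> sets borel" using E openC by auto
  next
    fix x t assume "x \<in> E - C q m k" "0 < t" "t < e k"
    then show "x + t *\<^sub>R q \<notin> E - C q m k"
      using e[of m] unfolding C_def by (auto dest!: spec[of _ q])
  qed (rule e)
  then have "AE x in lborel. \<not> x \<in> E - C q m k" for q m k
    by (rule AE_not_in)
  then have "AE x in lborel. \<forall>q\<in>Q. \<forall>m k. \<not> x \<in> E - C q m k"
    unfolding AE_ball_countable[OF Q(1)] AE_all_countable by blast
  then show ?thesis
  proof eventually_elim
    case (elim x)
    show ?case
    proof (intro impI allI)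
      fix v and r t0 :: real assume "x \<in> E" "r > 0" "t0 > 0"
      obtain m where m: "e m < r / 2"
        using nat_approx_posE[of "r/2"] \<open>r > 0\<close> by (auto simp: e_def)
      obtain k where k: "e k < t0"
        using nat_approx_posE[of "t0"] \<open>t0 > 0\<close> by (auto simp: e_def)
      obtain q where q: "q \<in> Q" "dist v q < r / 2"
        using Q(2)[of "ball v (r/2)"] \<open>r > 0\<close> by auto
      have "x \<in> C q m k" using elim \<open>x \<in> E\<close> q by blast
      then obtain u t where ut: "dist q u < e m" "0 < t" "t < e k" "x + t *\<^sub>R u \<in> E"
        by (auto simp: C_def)
      have "dist v u < r" using dist_triangle[of v u q] q ut m by linarith
      with ut k show "\<exists>u t. dist v u < r \<and> 0 < t \<and> t < t0 \<and> x + t *\<^sub>R u \<in> E"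
        by (intro exI[of _ u] exI[of _ t]) auto
    qed
  qed
qed

text \<open>The cone statement is applied to the part of \<open>G\<close> that \<open>T\<close> maps
  into \<open>V\<close>, for each \<open>V\<close> in a countable basis; a basic set around
  \<open>T x\<close> within the \<open>\<delta>\<close>-ball then controls \<open>T\<close> at the
  landing point.\<close>

lemma AE_lborel_approx_continuous_in_cones:
  fixes T :: "'a::euclidean_space \<Rightarrow> 'b::{second_countable_topology, metric_space}"
  assumes G: "G \<in> sets borel" and T: "T \<in> borel_measurable borel"
  shows "AE x in lborel. x \<in> G \<longrightarrow> (\<forall>v r t0 \<delta>. r > 0 \<longrightarrow> t0 > 0 \<longrightarrow> \<delta> > 0 \<longrightarrow>
           (\<exists>u t. dist v u < r \<and> 0 < t \<and> t < t0 \<and> x + t *\<^sub>R u \<in> G \<and> dist (T x) (T (x + t *\<^sub>R u)) < \<delta>))"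
proof -
  obtain B :: "'b set set" where B: "countable B" "topological_basis B"
    using ex_countable_basis by blast
  have "AE x in lborel. \<forall>V\<in>B. x \<in> G \<inter> T -` V \<longrightarrow> (\<forall>v r t0. r > 0 \<longrightarrow> t0 > 0 \<longrightarrow>
           (\<exists>u t. dist v u < r \<and> 0 < t \<and> t < t0 \<and> x + t *\<^sub>R u \<in> G \<inter> T -` V))"
  proof (rule AE_ball_countable'[OF _ B(1)])
    fix V assume "V \<in> B"
    then have "open V" using B(2) topological_basis_open by blast
    then have "T -` V \<in> sets borel"
      using measurable_sets[OF T, of V] by simp
    then have "G \<inter> T -` V \<in> sets borel" using G by auto
    from AE_lborel_meets_cones[OF this]
    show "AE x in lborel. x \<in> G \<inter> T -` V \<longrightarrow> (\<forall>v r t0. r > 0 \<longrightarrow> t0 > 0 \<longrightarrow>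
           (\<exists>u t. dist v u < r \<and> 0 < t \<and> t < t0 \<and> x + t *\<^sub>R u \<in> G \<inter> T -` V))" .
  qed
  then show ?thesis
  proof eventually_elim
    case (elim x)
    show ?case
    proof (intro impI allI)
      fix v and r t0 \<delta> :: real assume x: "x \<in> G" and pos: "r > 0" "t0 > 0" "\<delta> > 0"
      obtain V where V: "V \<in> B" "T x \<in> V" "V \<subseteq> ball (T x) \<delta>"
        using topological_basisE[OF B(2), of "ball (T x) \<delta>" "T x"] pos by auto
      with elim x pos obtain u t where "dist v u < r" "0 < t" "t < t0" "x + t *\<^sub>R u \<in> G \<inter> T -` V"
        by (metis IntI vimageI)
      then show "\<exists>u t. dist v u < r \<and> 0 < t \<and> t < t0 \<and> x + t *\<^sub>R u \<in> G \<and> dist (T x) (T (x + t *\<^sub>R u)) < \<delta>"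
        using V by (intro exI[of _ u] exI[of _ t]) auto
    qed
  qed
qed

subsection \<open>Monotone rearrangement along cycles\<close>

text \<open>The definition quantifies over initial segments of the naturals; an enumeration of
  \<open>I\<close> transfers it to any finite index set, and the maxima are traded for single
  indices.\<close>

lemma inf_c_cyclically_monotone_bij:
  assumes cm: "inf_c_cyclically_monotone c \<Gamma>" and I: "finite I" "bij_betw \<sigma> I I"
    and \<Gamma>: "\<And>i. i \<in> I \<Longrightarrow> (x i, y i) \<in> \<Gamma>" and j: "j \<in> I"
  shows "\<exists>i\<in>I. c (x j) (y j) \<le> c (x i) (y (\<sigma> i))"
proof -
  define k where "k = card I"
  obtain h where h: "bij_betw h {..<k} I"
    using ex_bij_betw_nat_finite[OF I(1)] by (auto simp: k_def atLeast0LessThan)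
  have k: "k \<ge> 1" using I(1) j by (auto simp: k_def Suc_le_eq card_gt_0_iff)
  \<comment> \<open>Conjugation of \<open>\<sigma>\<close> by the enumeration, continued by the
    identity as \<open>permutes\<close> demands.\<close>
  define \<tau> where "\<tau> i = (if i < k then inv_into {..<k} h (\<sigma> (h i)) else i)" for i
  have "bij_betw (inv_into {..<k} h \<circ> (\<sigma> \<circ> h)) {..<k} {..<k}"
    by (intro bij_betw_trans[OF bij_betw_trans[OF h I(2)] bij_betw_inv_into[OF h]])
  then have "bij_betw \<tau> {..<k} {..<k}"
    by (subst bij_betw_cong[where g = "inv_into {..<k} h \<circ> (\<sigma> \<circ> h)"]) (auto simp: \<tau>_def)
  then have \<tau>: "\<tau> permutes {..<k}"
    by (rule bij_imp_permutes) (simp add: \<tau>_def)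
  have h\<tau>: "h i \<in> I" "h (\<tau> i) = \<sigma> (h i)" if "i < k" for i
  proof -
    show "h i \<in> I" using h that by (auto dest: bij_betwE)
    then have "\<sigma> (h i) \<in> h ` {..<k}"
      using I(2) h by (auto dest: bij_betwE simp: bij_betw_imp_surj_on)
    then show "h (\<tau> i) = \<sigma> (h i)"
      using that by (simp add: \<tau>_def f_inv_into_f)
  qed
  have Maxle: "Max ((\<lambda>i. c (x (h i)) (y (h i))) ` {..<k})
        \<le> Max ((\<lambda>i. c (x (h i)) (y (h (\<tau> i)))) ` {..<k})"
    using cm[unfolded inf_c_cyclically_monotone_def, rule_format,
        of k "\<lambda>i. x (h i)" "\<lambda>i. y (h i)" \<tau>] k \<tau> \<Gamma> h\<tau>(1)
    by blast
  have ne: "{..<k} \<noteq> {}" using k by (auto simp: lessThan_empty_iff)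
  then have "Max ((\<lambda>i. c (x (h i)) (y (h (\<tau> i)))) ` {..<k})
      \<in> (\<lambda>i. c (x (h i)) (y (h (\<tau> i)))) ` {..<k}"
    by (intro Max_in) auto
  then obtain i where i: "i < k"
    "Max ((\<lambda>i. c (x (h i)) (y (h (\<tau> i)))) ` {..<k}) = c (x (h i)) (y (h (\<tau> i)))"
    by blast
  obtain j' where "j' < k" "h j' = j"
    using h j by (auto simp: bij_betw_def)
  then have "c (x j) (y j) \<le> Max ((\<lambda>i. c (x (h i)) (y (h i))) ` {..<k})"
    by (intro Max_ge) auto
  with Maxle i h\<tau>[of i] show ?thesis by force
qed

text \<open>Cyclic monotonicity is applied to the cycle of twice the length in which \<open>x j\<close> is sent
  to \<open>b j\<close> and \<open>a j\<close> to \<open>y (\<pi> j)\<close>.\<close>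

lemma inf_c_cyclically_monotone_detour:
  assumes cm: "inf_c_cyclically_monotone c \<Gamma>" and I: "finite I" "bij_betw \<pi> I I" and i0: "i0 \<in> I"
    and \<Gamma>: "\<And>j. j \<in> I \<Longrightarrow> (x j, y j) \<in> \<Gamma>" "\<And>j. j \<in> I \<Longrightarrow> (a j, b j) \<in> \<Gamma>"
    and "g > 0"
    and gap: "\<And>j. j \<in> I \<Longrightarrow> max (c (x j) (b j)) (c (a j) (y' j)) + g
                \<le> max (max (c (x j) (y j)) (c (x j) (y' j))) (c (a j) (b j))"
    and near: "\<And>j. j \<in> I \<Longrightarrow> c (a j) (y (\<pi> j)) < c (a j) (y' j) + g"
  shows "\<exists>j\<in>I. c (x i0) (y i0) < c (x j) (y' j)"
proof -
  define J where "J = I \<times> (UNIV :: bool set)"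
  define X where "X p = (if snd p then a (fst p) else x (fst p))" for p
  define Y where "Y p = (if snd p then b (fst p) else y (fst p))" for p
  \<comment> \<open>The flag separates original points (\<open>False\<close>) from detour points
    (\<open>True\<close>): \<open>x j\<close> takes the target \<open>b j\<close>, and
    \<open>a j\<close> the target \<open>y (\<pi> j)\<close>.\<close>
  define \<sigma> where "\<sigma> p = (if snd p then (\<pi> (fst p), False) else (fst p, True))" for p
  have J: "finite J" "J \<noteq> {}" using I i0 by (auto simp: J_def)
  have \<pi>: "\<And>i. i \<in> I \<Longrightarrow> \<pi> i \<in> I" "inj_on \<pi> I"
    using I(2) by (auto dest: bij_betwE simp: bij_betw_def)
  have "inj_on \<sigma> J"
    using \<pi>(2) by (auto simp: inj_on_def J_def \<sigma>_def split: if_splits)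
  moreover have "\<sigma> ` J \<subseteq> J" using \<pi>(1) by (auto simp: J_def \<sigma>_def)
  ultimately have \<sigma>: "bij_betw \<sigma> J J"
    using J(1) by (simp add: bij_betw_def endo_inj_surj)
  define M where "M = Max ((\<lambda>p. c (X p) (Y p)) ` J)"
  have "M \<in> (\<lambda>p. c (X p) (Y p)) ` J"
    unfolding M_def using J by (intro Max_in) auto
  then obtain p where p: "p \<in> J" "M = c (X p) (Y p)" by blast
  have M: "c (X q) (Y q) \<le> M" if "q \<in> J" for q
    unfolding M_def using J that by (intro Max_ge) auto
  have "(X q, Y q) \<in> \<Gamma>" if "q \<in> J" for q
    using that \<Gamma> by (auto simp: J_def X_def Y_def)
  from inf_c_cyclically_monotone_bij[where x = X and y = Y, OF cm J(1) \<sigma> this p(1)]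
  obtain q where q: "q \<in> J" "M \<le> c (X q) (Y (\<sigma> q))"
    using p(2) by auto
  obtain j u where j: "q = (j, u)" "j \<in> I" using q by (auto simp: J_def)
  have "c (X q) (Y (\<sigma> q)) < max (c (x j) (b j)) (c (a j) (y' j)) + g"
    using j near[OF j(2)] \<open>g > 0\<close> by (cases u) (auto simp: X_def Y_def \<sigma>_def)
  also have "\<dots> \<le> max (max (c (x j) (y j)) (c (x j) (y' j))) (c (a j) (b j))"
    by (rule gap[OF j(2)])
  \<comment> \<open>Two of the three costs belong to the cycle itself and are at most
    \<open>M\<close>, so only \<open>c (x j) (y' j)\<close> can exceed \<open>M\<close>.\<close>
  also have "\<dots> \<le> max M (c (x j) (y' j))"
    using M[of "(j, False)"] M[of "(j, True)"] j by (auto simp: J_def X_def Y_def)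
  finally have "M < c (x j) (y' j)" using q by auto
  moreover have "c (x i0) (y i0) \<le> M"
    using M[of "(i0, False)"] i0 by (auto simp: J_def X_def Y_def)
  ultimately show ?thesis using j by force
qed

text \<open>From an index maximising \<open>c (x j) (y' j)\<close>, the detour inequality for
  \<open>\<Gamma>'\<close> leads to a larger \<open>c (x i) (y i)\<close>, and the one for
  \<open>\<Gamma>\<close> to a still larger \<open>c (x k) (y' k)\<close>, against
  maximality.\<close>

lemma no_common_cycle:
  assumes cm: "inf_c_cyclically_monotone c \<Gamma>" and cm': "inf_c_cyclically_monotone c \<Gamma>'"
    and I: "finite I" "bij_betw \<pi> I I" "I \<noteq> {}" and "g > 0"
    and \<Gamma>: "\<And>j. j \<in> I \<Longrightarrow> (x j, y j) \<in> \<Gamma>" "\<And>j. j \<in> I \<Longrightarrow> (a j, b j) \<in> \<Gamma>"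
    and \<Gamma>': "\<And>j. j \<in> I \<Longrightarrow> (x j, y' j) \<in> \<Gamma>'" "\<And>j. j \<in> I \<Longrightarrow> (a' j, b' j) \<in> \<Gamma>'"
    and gap: "\<And>j. j \<in> I \<Longrightarrow> max (c (x j) (b j)) (c (a j) (y' j)) + g
                \<le> max (max (c (x j) (y j)) (c (x j) (y' j))) (c (a j) (b j))"
    and gap': "\<And>j. j \<in> I \<Longrightarrow> max (c (x j) (b' j)) (c (a' j) (y j)) + g
                \<le> max (max (c (x j) (y' j)) (c (x j) (y j))) (c (a' j) (b' j))"
    and near: "\<And>i j. \<lbrakk>i \<in> I; j \<in> I\<rbrakk> \<Longrightarrow> c (a i) (y (\<pi> j)) < c (a i) (y' j) + g"
    and near': "\<And>i j. \<lbrakk>i \<in> I; j \<in> I\<rbrakk> \<Longrightarrow> c (a' i) (y' j) < c (a' i) (y (\<pi> j)) + g"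
  shows False
proof -
  define M where "M = Max ((\<lambda>j. c (x j) (y' j)) ` I)"
  have "M \<in> (\<lambda>j. c (x j) (y' j)) ` I"
    unfolding M_def using I by (intro Max_in) auto
  then obtain j where j: "j \<in> I" "M = c (x j) (y' j)" by blast
  have M: "c (x i) (y' i) \<le> M" if "i \<in> I" for i
    unfolding M_def using I that by (intro Max_ge) auto
  \<comment> \<open>Exchanging \<open>y\<close> and \<open>y'\<close> reverses the cycle: the target
    close to \<open>y i\<close> is \<open>y'\<close> at the predecessor of \<open>i\<close>.\<close>
  define \<rho> where "\<rho> = inv_into I \<pi>"
  have \<rho>: "bij_betw \<rho> I I" unfolding \<rho>_def by (rule bij_betw_inv_into[OF I(2)])
  have \<rho>': "\<rho> i \<in> I" "\<pi> (\<rho> i) = i" if "i \<in> I" for i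
    using that \<rho> I(2) by (auto dest: bij_betwE simp: \<rho>_def bij_betw_inv_into_right)
  have "c (a' i) (y' (\<rho> i)) < c (a' i) (y i) + g" if "i \<in> I" for i
    using near'[OF that \<rho>'(1)[OF that]] \<rho>'(2)[OF that] by simp
  with inf_c_cyclically_monotone_detour[where x = x and y = y' and a = a' and b = b' and y' = y,
      OF cm' I(1) \<rho> j(1) \<Gamma>' \<open>g > 0\<close> gap']
  obtain i where i: "i \<in> I" "M < c (x i) (y i)" using j(2) by auto
  with inf_c_cyclically_monotone_detour[where x = x and y = y and a = a and b = b and y' = y',
      OF cm I(1,2) i(1) \<Gamma> \<open>g > 0\<close> gap near]
  obtain k where "k \<in> I" "c (x i) (y i) < c (x k) (y' k)" by blast
  with M[of k] i show False by linarith
qed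

text \<open>If no \<open>\<epsilon>\<close>-chain in \<open>K\<close> led from \<open>y0\<close> back to \<open>y0\<close>, then the set \<open>R\<close> of targets reachable
  from \<open>y0\<close> would receive, through \<open>T'\<close>, more mass than \<open>T\<close> takes out of it.\<close>

lemma (in finite_measure) approximate_cycle_through_atom:
  fixes T T' :: "'a \<Rightarrow> 'b::{second_countable_topology, metric_space}"
  assumes T: "T \<in> borel_measurable M" and T': "T' \<in> borel_measurable M"
    and push: "distr M borel T = distr M borel T'"
    and D: "D = {x \<in> space M. T x \<noteq> T' x}" and K: "K \<in> sets M"
    and less: "emeasure M (D - K) < emeasure M {x \<in> space M. T x = y0 \<and> T' x \<noteq> y0}"
    and "\<epsilon> > 0"
  obtains I :: "nat set" and \<pi> f where "finite I" "I \<noteq> {}" "bij_betw \<pi> I I"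
    "\<And>i. i \<in> I \<Longrightarrow> f i \<in> K" "\<And>i. i \<in> I \<Longrightarrow> dist (T' (f i)) (T (f (\<pi> i))) < \<epsilon>"
proof -
  define chain where "chain k f \<longleftrightarrow> (\<forall>i\<le>k. f i \<in> K) \<and> T (f 0) = y0 \<and>
      (\<forall>i<k. dist (T' (f i)) (T (f (Suc i))) < \<epsilon>)" for k :: nat and f
  define P where "P = {f k | k f. chain k f}"
  \<comment> \<open>As a union of balls \<open>R\<close> is open, hence Borel, whatever the
    measurability of \<open>P\<close>.\<close>
  define R where "R = (\<Union>x\<in>P. ball (T' x) \<epsilon>)"
  have P_step: "z \<in> P" if "x \<in> P" "z \<in> K" "dist (T' x) (T z) < \<epsilon>" for x z
  proof -
    obtain k f where "chain k f" "x = f k" using \<open>x \<in> P\<close> unfolding P_def by blast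
    then have "chain (Suc k) (f(Suc k := z))"
      using that by (auto simp: chain_def le_Suc_eq less_Suc_eq)
    then show ?thesis unfolding P_def
      by (intro CollectI exI[of _ "Suc k"] exI[of _ "f(Suc k := z)"]) simp
  qed
  have P_init: "z \<in> P" if "z \<in> K" "T z = y0" for z
  proof -
    have "chain 0 (\<lambda>_. z)" using that by (auto simp: chain_def)
    then show ?thesis unfolding P_def by (intro CollectI exI[of _ 0] exI[of _ "\<lambda>_. z"]) simp
  qed
  have "y0 \<in> R"
  proof (rule ccontr)
    assume y0: "y0 \<notin> R"
    have R: "R \<in> sets borel" unfolding R_def by (intro borel_open open_UN) auto
    note [measurable] = T T' K R
    define A where "A = {x \<in> space M. T x = y0 \<and> T' x \<noteq> y0}"
    have Dm[measurable]: "D \<in> sets M" unfolding D by measurable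
    have Am[measurable]: "A \<in> sets M" unfolding A_def by measurable
    define B where "B = {x \<in> D. T x \<in> R}"
    define B' where "B' = {x \<in> D. T' x \<in> R}"
    define C where "C = {x \<in> space M. T x = T' x \<and> T x \<in> R}"
    have B_eq: "B = D \<inter> (T -` R \<inter> space M)" "B' = D \<inter> (T' -` R \<inter> space M)"
      by (auto simp: B_def B'_def D)
    have Bm[measurable]: "B \<in> sets M" "B' \<in> sets M" unfolding B_eq by measurable
    have Cm[measurable]: "C \<in> sets M" unfolding C_def by measurable
    \<comment> \<open>Both maps give \<open>R\<close> the same mass, and the part \<open>C\<close>
      where they agree cancels.\<close>
    have "measure M B + measure M C = measure M (B \<union> C)"
      by (rule finite_measure_Union[symmetric]) (auto simp: B_def C_def D)
    also have "B \<union> C = T -` R \<inter> space M" by (auto simp: B_def C_def D)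
    also have "measure M \<dots> = measure (distr M borel T) R"
      by (simp add: measure_distr)
    also have "\<dots> = measure M (T' -` R \<inter> space M)"
      unfolding push by (simp add: measure_distr)
    also have "T' -` R \<inter> space M = B' \<union> C" by (auto simp: B'_def C_def D)
    also have "measure M \<dots> = measure M B' + measure M C"
      by (rule finite_measure_Union) (auto simp: B'_def C_def D)
    finally have BB': "measure M B = measure M B'" by simp
    have "measure M A + measure M B = measure M (A \<union> B)"
      by (rule finite_measure_Union[symmetric]) (use y0 in \<open>auto simp: A_def B_def\<close>)
    also have "\<dots> \<le> measure M (B' \<union> (D - K))"
    proof (rule finite_measure_mono)
      \<comment> \<open>A point of \<open>K\<close> that \<open>T\<close> sends to \<open>y0\<close>
        starts a chain, and one sent into \<open>R\<close> continues a chain; either way its image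
        under \<open>T'\<close> is again in \<open>R\<close>. Only points of \<open>D - K\<close>
        can escape.\<close>
      have "T' x \<in> R" if "x \<in> K" "T x = y0 \<or> T x \<in> R" for x
      proof -
        have "x \<in> P" using that P_init P_step[of _ x] by (auto simp: R_def)
        then show ?thesis using \<open>\<epsilon> > 0\<close> by (auto simp: R_def intro!: bexI[of _ x])
      qed
      then show "A \<union> B \<subseteq> B' \<union> (D - K)" by (auto simp: A_def B_def B'_def D)
    qed measurable
    also have "\<dots> \<le> measure M B' + measure M (D - K)"
      by (rule measure_Un_le) measurable
    finally have "measure M A \<le> measure M (D - K)" using BB' by simp
    with less show False
      by (simp add: A_def[symmetric] emeasure_eq_measure ennreal_less_iff)
  qed
  then obtain k f where f: "chain k f" "dist (T' (f k)) y0 < \<epsilon>"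
    by (auto simp: R_def P_def)
  \<comment> \<open>The wrap from \<open>k\<close> to \<open>0\<close> closes the chain, because
    \<open>T (f 0) = y0\<close>.\<close>
  define \<pi> where "\<pi> i = (if i = k then 0 else Suc i)" for i
  have "inj_on \<pi> {..k}" "\<pi> ` {..k} \<subseteq> {..k}"
    by (auto simp: inj_on_def \<pi>_def split: if_splits)
  then have "bij_betw \<pi> {..k} {..k}" by (simp add: bij_betw_def endo_inj_surj)
  then show ?thesis
    using f by (intro that[of "{..k}" \<pi> f]) (auto simp: \<pi>_def chain_def)
qed

subsection \<open>Strictly quasiconvex twisted costs\<close>

locale quasiconvex_cost =
  fixes c :: "'a::euclidean_space \<Rightarrow> 'a \<Rightarrow> real"
  assumes cont: "continuous_on UNIV (\<lambda>(x, y). c x y)"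
    and nonneg: "c x y \<ge> 0"
    and unique_zero: "\<exists>!y. c x y = 0"
    and inf_zero: "(INF x. c x y) = 0"
    and quasiconvex: "strictly_quasiconvex (\<lambda>z. c z y)"
    and sublevel_C1: "l > 0 \<Longrightarrow> C1_boundary {z. c z y \<le> l}"
    and twist: "\<lbrakk>l > 0; c x y = l; c x y' = l; outer_normal {z. c z y \<le> l} x n;
                 outer_normal {z. c z y' \<le> l} x n\<rbrakk> \<Longrightarrow> y = y'"
begin

lemma continuous_on_c [continuous_intros]:
  assumes "continuous_on A f" "continuous_on A g"
  shows "continuous_on A (\<lambda>x. c (f x) (g x))"
  using continuous_on_compose2[OF cont continuous_on_Pair[OF assms]] by simp

lemma exists_smaller: "l > 0 \<Longrightarrow> \<exists>z. c z y < l"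
proof (rule ccontr)
  assume l: "l > 0" and "\<nexists>z. c z y < l"
  then have "l \<le> (INF x. c x y)" by (intro cINF_greatest) (auto simp: not_less)
  with l inf_zero show False by simp
qed

lemma cost_normal:
  assumes "c x y > 0"
  obtains n where "outer_normal {z. c z y \<le> c x y} x n" "norm n = 1"
    "\<And>u. n \<bullet> u < 0 \<Longrightarrow> \<exists>s>0. c (x + s *\<^sub>R u) y < c x y"
proof -
  obtain z where "c z y < c x y" using exists_smaller[OF assms] by blast
  then obtain n where n: "outer_normal {z. c z y \<le> c x y} x n" "norm n = 1"
    using outer_normal_exists[OF quasiconvex sublevel_C1[OF assms]] by blast
  then show ?thesis
    using outer_normal_descent[OF quasiconvex n(1)] by (intro that[of n]) auto
qed

text \<open>For equal costs, twistedness gives distinct unit normals \<open>n\<close> and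
  \<open>n'\<close>, hence \<open>n \<bullet> n' < 1\<close>, and \<open>n - n'\<close> points
  outwards for \<open>y\<close> and inwards for \<open>y'\<close>. For unequal costs only the larger
  one imposes a condition, met by its own normal up to sign.\<close>

lemma separating_direction:
  assumes "y \<noteq> y'"
  obtains v where
    "c x y' \<le> c x y \<Longrightarrow> \<exists>s>0. c (x - s *\<^sub>R v) y < c x y"
    "c x y \<le> c x y' \<Longrightarrow> \<exists>s>0. c (x + s *\<^sub>R v) y' < c x y'"
proof -
  have pos: "c x y > 0 \<or> c x y' > 0"
    using unique_zero[of x] assms nonneg by (metis less_eq_real_def)
  consider "c x y = c x y'" | "c x y < c x y'" | "c x y' < c x y" by linarith
  then show ?thesis
  proof cases
    case 1
    with pos have p: "c x y > 0" "c x y' > 0" by auto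
    obtain n where n: "outer_normal {z. c z y \<le> c x y} x n" "norm n = 1"
      and dn: "\<And>u. n \<bullet> u < 0 \<Longrightarrow> \<exists>s>0. c (x + s *\<^sub>R u) y < c x y"
      using cost_normal[OF p(1)] by blast
    obtain n' where n': "outer_normal {z. c z y' \<le> c x y'} x n'" "norm n' = 1"
      and dn': "\<And>u. n' \<bullet> u < 0 \<Longrightarrow> \<exists>s>0. c (x + s *\<^sub>R u) y' < c x y'"
      using cost_normal[OF p(2)] by blast
    have "n \<noteq> n'" using twist[OF p(1) refl 1[symmetric], of n] n n' 1 assms by auto
    then have "norm (n - n') ^ 2 > 0" by simp
    then have "2 - 2 * (n \<bullet> n') > 0"
      using n(2) n'(2) by (simp add: power2_norm_eq_inner inner_diff inner_commute norm_eq_1)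
    then have "n \<bullet> (-(n - n')) < 0" "n' \<bullet> (n - n') < 0"
      using n(2) n'(2) by (auto simp: inner_diff inner_commute norm_eq_1)
    with dn[of "-(n - n')"] dn'[of "n - n'"] show ?thesis
      by (intro that[of "n - n'"]) (auto simp: algebra_simps)
  next
    case 2
    then have "c x y' > 0" using nonneg[of x y] by linarith
    then obtain n' where n': "norm n' = 1"
      and dn': "\<And>u. n' \<bullet> u < 0 \<Longrightarrow> \<exists>s>0. c (x + s *\<^sub>R u) y' < c x y'"
      using cost_normal by blast
    have "n' \<bullet> (-n') < 0" using n' by (auto simp: norm_eq_1)
    from dn'[OF this] 2 show ?thesis by (intro that[of "-n'"]) auto
  next
    case 3
    then have "c x y > 0" using nonneg[of x y'] by linarith
    then obtain n where n: "norm n = 1"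
      and dn: "\<And>u. n \<bullet> u < 0 \<Longrightarrow> \<exists>s>0. c (x + s *\<^sub>R u) y < c x y"
      using cost_normal by blast
    have "n \<bullet> (-n) < 0" using n by (auto simp: norm_eq_1)
    from dn[OF this] 3 show ?thesis by (intro that[of "n"]) auto
  qed
qed

text \<open>Rerouting \<open>x \<rightarrow> y'\<close> as \<open>x \<rightarrow> w\<close>, \<open>z \<rightarrow> y'\<close> is strictly cheaper for all \<open>z\<close> in a small cone
  at \<open>x\<close> and all \<open>w\<close> in a neighbourhood of \<open>y\<close> that does not depend on \<open>z\<close>.\<close>

lemma cheaper_detour_in_cone:
  assumes "y \<noteq> y'"
  obtains v r t0 \<delta> where "r > 0" "t0 > 0" "\<delta> > 0"
    "\<And>u t w. \<lbrakk>dist v u < r; 0 < t; t < t0; dist y w < \<delta>\<rbrakk> \<Longrightarrow>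
       max (c x w) (c (x + t *\<^sub>R u) y') < max (max (c x y) (c x y')) (c (x + t *\<^sub>R u) w)"
proof -
  define F where "F = max (c x y) (c x y')"
  obtain v where v1: "c x y' \<le> c x y \<Longrightarrow> \<exists>s>0. c (x - s *\<^sub>R v) y < c x y"
    and v2: "c x y \<le> c x y' \<Longrightarrow> \<exists>s>0. c (x + s *\<^sub>R v) y' < c x y'"
    using separating_direction[OF assms] by blast
  \<comment> \<open>Bound on \<open>c x w\<close>. If \<open>c x y < F\<close>, it is continuity in
    \<open>w\<close>. Otherwise the descent at \<open>x - s *\<^sub>R v\<close> persists for
    \<open>u\<close> near \<open>v\<close> and \<open>w\<close> near \<open>y\<close>, and
    quasiconvexity turns it into an increase at every \<open>t > 0\<close>.\<close>
  have "\<exists>r \<delta>. r > 0 \<and> \<delta> > 0 \<and> (\<forall>u t w. dist v u < r \<longrightarrow> 0 < t \<longrightarrow> dist y w < \<delta> \<longrightarrow>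
          c x w < max F (c (x + t *\<^sub>R u) w))"
  proof (cases "c x y < F")
    case True
    obtain e where "e > 0" "\<And>w. dist y w < e \<Longrightarrow> c x w < F"
      by (rule continuous_less_on_ball[of "c x", OF _ True]) (auto intro!: continuous_intros)
    then show ?thesis by (intro exI[of _ 1] exI[of _ e]) (auto simp: less_max_iff_disj)
  next
    case False
    then have "c x y' \<le> c x y" by (auto simp: F_def)
    with v1 obtain s where s: "s > 0" "c (x - s *\<^sub>R v) y < c x y" by blast
    define f where "f = (\<lambda>p. c (x - s *\<^sub>R fst p) (snd p) - c x (snd p))"
    have "continuous_on UNIV f" unfolding f_def by (intro continuous_intros)
    moreover have "f (v, y) < 0" using s by (simp add: f_def)
    ultimately obtain e where e: "e > 0" "\<And>p. dist (v, y) p < e \<Longrightarrow> f p < 0"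
      by (rule continuous_less_on_ball) blast
    have "c x w < c (x + t *\<^sub>R u) w" if "dist v u < e / 2" "dist y w < e / 2" "0 < t" for u t w
    proof -
      have "dist (v, y) (u, w) < e"
        using that sqrt_sum_squares_le_sum[of "dist v u" "dist y w"] by (simp add: dist_Pair_Pair)
      then have "c (x - s *\<^sub>R u) w < c x w" using e by (force simp: f_def)
      then show ?thesis
        using strictly_quasiconvex_increasing_along[OF quasiconvex, of x s u w t] s that by simp
    qed
    then show ?thesis using e
      by (intro exI[of _ "e/2"]) (auto simp: less_max_iff_disj)
  qed
  then obtain r1 \<delta> where r1: "r1 > 0" "\<delta> > 0"
    and H1: "\<And>u t w. \<lbrakk>dist v u < r1; 0 < t; dist y w < \<delta>\<rbrakk> \<Longrightarrow> c x w < max F (c (x + t *\<^sub>R u) w)"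
    by blast
  \<comment> \<open>Bound on the cost to \<open>y'\<close>. If \<open>c x y' < F\<close>, it is
    continuity at \<open>t = 0\<close>. Otherwise the descent at step \<open>s\<close> is stable in
    \<open>u\<close> and inherited by all shorter steps.\<close>
  have "\<exists>r t0. r > 0 \<and> t0 > 0 \<and> (\<forall>u t. dist v u < r \<longrightarrow> 0 < t \<longrightarrow> t < t0 \<longrightarrow> c (x + t *\<^sub>R u) y' < F)"
  proof (cases "c x y' < F")
    case True
    define f where "f = (\<lambda>p. c (x + snd p *\<^sub>R fst p) y')"
    have "continuous_on UNIV f" unfolding f_def by (intro continuous_intros)
    moreover have "f (v, 0) < F" using True by (simp add: f_def)
    ultimately obtain e where e: "e > 0" "\<And>p. dist (v, 0) p < e \<Longrightarrow> f p < F"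
      by (rule continuous_less_on_ball) blast
    have "c (x + t *\<^sub>R u) y' < F" if "dist v u < e / 2" "0 < t" "t < e / 2" for u t
    proof -
      have "dist (v, 0) (u, t) < e"
        using that sqrt_sum_squares_le_sum[of "dist v u" "dist 0 t"] by (simp add: dist_Pair_Pair)
      then show ?thesis using e by (force simp: f_def)
    qed
    then show ?thesis using e by (intro exI[of _ "e/2"]) auto
  next
    case False
    then have "c x y \<le> c x y'" and F: "F = c x y'" by (auto simp: F_def)
    with v2 obtain s where s: "s > 0" "c (x + s *\<^sub>R v) y' < c x y'" by blast
    have "continuous_on UNIV (\<lambda>u. c (x + s *\<^sub>R u) y')" by (intro continuous_intros)
    then obtain e where e: "e > 0" "\<And>u. dist v u < e \<Longrightarrow> c (x + s *\<^sub>R u) y' < c x y'"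
      using s(2) by (rule continuous_less_on_ball) blast
    have "c (x + t *\<^sub>R u) y' < F" if "dist v u < e" "0 < t" "t < s" for u t
      using strictly_quasiconvex_decreasing_along[OF quasiconvex e(2)[OF that(1)], of t] that F by simp
    then show ?thesis using e s by (intro exI[of _ "e"] exI[of _ s]) auto
  qed
  then obtain r2 t0 where r2: "r2 > 0" "t0 > 0"
    and H2: "\<And>u t. \<lbrakk>dist v u < r2; 0 < t; t < t0\<rbrakk> \<Longrightarrow> c (x + t *\<^sub>R u) y' < F"
    by blast
  show ?thesis
  proof (rule that[of "min r1 r2" t0 \<delta> v])
    fix u t w assume *: "dist v u < min r1 r2" "0 < t" "t < t0" "dist y w < \<delta>"
    then show "max (c x w) (c (x + t *\<^sub>R u) y') < max (max (c x y) (c x y')) (c (x + t *\<^sub>R u) w)"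
      using H1[of u t w] H2[of u t] unfolding F_def[symmetric] by auto
  qed (use r1 r2 in auto)
qed

text \<open>The null set is fixed before the cone is chosen, so one exceptional set serves all
  \<open>y'\<close>.\<close>

lemma AE_cheaper_detour:
  assumes G: "G \<in> sets borel" and T: "T \<in> borel_measurable borel"
  shows "AE x in lborel. x \<in> G \<longrightarrow> (\<forall>y'. y' \<noteq> T x \<longrightarrow>
    (\<exists>a\<in>G. max (c x (T a)) (c a y') < max (max (c x (T x)) (c x y')) (c a (T a))))"
  using AE_lborel_approx_continuous_in_cones[OF G T]
proof eventually_elim
  case (elim x)
  show ?case
  proof (intro impI allI)
    fix y' assume x: "x \<in> G" and "y' \<noteq> T x"
    then obtain v r t0 \<delta> where "r > 0" "t0 > 0" "\<delta> > 0" and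
      H: "\<And>u t w. \<lbrakk>dist v u < r; 0 < t; t < t0; dist (T x) w < \<delta>\<rbrakk> \<Longrightarrow>
       max (c x w) (c (x + t *\<^sub>R u) y') < max (max (c x (T x)) (c x y')) (c (x + t *\<^sub>R u) w)"
      using cheaper_detour_in_cone[of "T x" y' x] by metis
    with elim x obtain u t where "dist v u < r" "0 < t" "t < t0" "x + t *\<^sub>R u \<in> G"
      "dist (T x) (T (x + t *\<^sub>R u)) < \<delta>"
      by blast
    with H[of u t "T (x + t *\<^sub>R u)"]
    show "\<exists>a\<in>G. max (c x (T a)) (c a y') < max (max (c x (T x)) (c x y')) (c a (T a))"
      by blast
  qed
qed

text \<open>The index \<open>n\<close> bounds both the gain from below and the detour point from
  above. Since \<open>y\<close> is a free coordinate instead of \<open>T x\<close>, the map enters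
  only through the parameter \<open>a\<close>, and the set is a union of open sets.\<close>

definition detour_gap :: "('a \<Rightarrow> 'a) \<Rightarrow> 'a set \<Rightarrow> nat \<Rightarrow> ('a \<times> 'a \<times> 'a) set" where
  "detour_gap T G n = (\<Union>a\<in>{a\<in>G. norm a \<le> real n}. {(x, y, y').
     max (c x (T a)) (c a y') + 1 / real (Suc n) < max (max (c x y) (c x y')) (c a (T a))})"

lemma open_detour_gap: "open (detour_gap T G n)"
proof -
  have "open {p :: 'a \<times> 'a \<times> 'a. max (c (fst p) (T a)) (c a (snd (snd p))) + 1 / real (Suc n)
      < max (max (c (fst p) (fst (snd p))) (c (fst p) (snd (snd p)))) (c a (T a))}" for a
    by (intro open_Collect_less continuous_intros)
  then show ?thesis
    unfolding detour_gap_def by (simp add: case_prod_beta' open_UN)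
qed

lemma detour_gap_mono: "m \<le> n \<Longrightarrow> detour_gap T G m \<subseteq> detour_gap T G n"
proof
  fix p assume "m \<le> n" "p \<in> detour_gap T G m"
  then obtain a x y y' where a: "p = (x, y, y')" "a \<in> G" "norm a \<le> real m"
    "max (c x (T a)) (c a y') + 1 / real (Suc m) < max (max (c x y) (c x y')) (c a (T a))"
    by (auto simp: detour_gap_def)
  moreover have "1 / real (Suc n) \<le> 1 / real (Suc m)"
    using \<open>m \<le> n\<close> by (simp add: frac_le)
  ultimately have "max (c x (T a)) (c a y') + 1 / real (Suc n)
      < max (max (c x y) (c x y')) (c a (T a))" and "norm a \<le> real n"
    using \<open>m \<le> n\<close> by linarith+
  with a show "p \<in> detour_gap T G n"
    unfolding detour_gap_def by blast
qed

lemma in_some_detour_gap: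
  assumes "a \<in> G" "max (c x (T a)) (c a y') < max (max (c x y) (c x y')) (c a (T a))"
  shows "\<exists>n. (x, y, y') \<in> detour_gap T G n"
proof -
  obtain m where m: "1 / real (Suc m) < max (max (c x y) (c x y')) (c a (T a)) - max (c x (T a)) (c a y')"
    using nat_approx_posE assms(2) by (metis diff_gt_0_iff_gt)
  obtain k where k: "norm a \<le> real k" using real_arch_simple by blast
  define n where "n = max m k"
  have "1 / real (Suc n) \<le> 1 / real (Suc m)" by (simp add: n_def frac_le)
  then have "max (c x (T a)) (c a y') + 1 / real (Suc n) < max (max (c x y) (c x y')) (c a (T a))"
    using m by linarith
  moreover have "norm a \<le> real n" using k by (simp add: n_def)
  ultimately have "(x, y, y') \<in> detour_gap T G n"
    using assms(1) unfolding detour_gap_def by blast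
  then show ?thesis ..
qed

text \<open>All targets and detour points lie in the ball of radius \<open>n\<close>, so uniform
  continuity of \<open>c\<close> there provides one \<open>\<epsilon>\<close>, valid for cycles of
  any length, whose error stays below the gain.\<close>

lemma monotone_maps_no_approximate_cycle:
  assumes cm: "inf_c_cyclically_monotone c \<Gamma>" and cm': "inf_c_cyclically_monotone c \<Gamma>'"
    and G: "\<And>x. x \<in> G \<Longrightarrow> (x, T x) \<in> \<Gamma>" "\<And>x. x \<in> G \<Longrightarrow> (x, T' x) \<in> \<Gamma>'"
    and K: "K \<subseteq> {x\<in>G. norm (T x) \<le> real n \<and> norm (T' x) \<le> real n \<and>
       (x, T x, T' x) \<in> detour_gap T G n \<and> (x, T' x, T x) \<in> detour_gap T' G n}"
  obtains \<epsilon> where "\<epsilon> > 0"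
    "\<And>(I :: 'i set) \<pi> f. \<lbrakk>finite I; I \<noteq> {}; bij_betw \<pi> I I; \<And>i. i \<in> I \<Longrightarrow> f i \<in> K;
        \<And>i. i \<in> I \<Longrightarrow> dist (T' (f i)) (T (f (\<pi> i))) < \<epsilon>\<rbrakk> \<Longrightarrow> False"
proof -
  define g where "g = 1 / real (Suc n)"
  have g: "g > 0" by (simp add: g_def)
  define C where "C = cball (0::'a) (real n)"
  have "uniformly_continuous_on (C \<times> C) (\<lambda>(x, y). c x y)"
    by (intro compact_uniformly_continuous continuous_on_subset[OF cont] compact_Times)
       (auto simp: C_def)
  then obtain \<epsilon> where \<epsilon>: "\<epsilon> > 0" and uc: "\<And>p q. \<lbrakk>p \<in> C \<times> C; q \<in> C \<times> C; dist q p < \<epsilon>\<rbrakk>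
      \<Longrightarrow> dist ((\<lambda>(x, y). c x y) q) ((\<lambda>(x, y). c x y) p) < g"
    using g unfolding uniformly_continuous_on_def by metis
  have close: "c a y < c a y' + g" if "norm a \<le> real n" "norm y \<le> real n" "norm y' \<le> real n" "dist y y' < \<epsilon>" for a y y'
    using uc[of "(a, y')" "(a, y)"] that by (auto simp: C_def dist_Pair_Pair dist_real_def)
  show ?thesis
  proof (rule that[OF \<epsilon>])
    fix I :: "'i set" and \<pi> f
    assume I: "finite I" "I \<noteq> {}" "bij_betw \<pi> I I" and fK: "\<And>i. i \<in> I \<Longrightarrow> f i \<in> K"
      and d: "\<And>i. i \<in> I \<Longrightarrow> dist (T' (f i)) (T (f (\<pi> i))) < \<epsilon>"
    have f: "f i \<in> G" "norm (T (f i)) \<le> real n" "norm (T' (f i)) \<le> real n" if "i \<in> I" for i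
      using fK[OF that] K by auto
    have \<pi>: "\<pi> i \<in> I" if "i \<in> I" for i using I(3) that by (auto dest: bij_betwE)
    have "\<exists>a\<in>G. norm a \<le> real n \<and> max (c (f i) (T a)) (c a (T' (f i))) + g
        < max (max (c (f i) (T (f i))) (c (f i) (T' (f i)))) (c a (T a))" if "i \<in> I" for i
      using fK[OF that] K by (auto simp: detour_gap_def g_def)
    then obtain a where a: "\<And>i. i \<in> I \<Longrightarrow> a i \<in> G" "\<And>i. i \<in> I \<Longrightarrow> norm (a i) \<le> real n"
      "\<And>i. i \<in> I \<Longrightarrow> max (c (f i) (T (a i))) (c (a i) (T' (f i))) + g
        < max (max (c (f i) (T (f i))) (c (f i) (T' (f i)))) (c (a i) (T (a i)))"
      by metis
    have "\<exists>a\<in>G. norm a \<le> real n \<and> max (c (f i) (T' a)) (c a (T (f i))) + g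
        < max (max (c (f i) (T' (f i))) (c (f i) (T (f i)))) (c a (T' a))" if "i \<in> I" for i
      using fK[OF that] K by (auto simp: detour_gap_def g_def)
    then obtain a' where a': "\<And>i. i \<in> I \<Longrightarrow> a' i \<in> G" "\<And>i. i \<in> I \<Longrightarrow> norm (a' i) \<le> real n"
      "\<And>i. i \<in> I \<Longrightarrow> max (c (f i) (T' (a' i))) (c (a' i) (T (f i))) + g
        < max (max (c (f i) (T' (f i))) (c (f i) (T (f i)))) (c (a' i) (T' (a' i)))"
      by metis
    show False
    proof (rule no_common_cycle[OF cm cm' I(1,3,2) g, of f "\<lambda>i. T (f i)" a "\<lambda>i. T (a i)"
          "\<lambda>i. T' (f i)" a' "\<lambda>i. T' (a' i)"])
      fix i j assume ij: "i \<in> I" "j \<in> I"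
      show "c (a i) (T (f (\<pi> j))) < c (a i) (T' (f j)) + g"
        by (rule close) (use ij a f \<pi> d[of j] in \<open>auto simp: dist_commute\<close>)
      show "c (a' i) (T' (f j)) < c (a' i) (T (f (\<pi> j))) + g"
        by (rule close) (use ij a' f \<pi> d[of j] in \<open>auto simp: dist_commute\<close>)
    qed (use G f a a' in \<open>auto simp: less_imp_le\<close>)
  qed
qed

end

section \<open>Exhausting the set where the two maps differ\<close>

theorem theorem3p3:
  fixes \<mu> \<nu> :: "'a::euclidean_space measure"
    and c :: "'a \<Rightarrow> 'a \<Rightarrow> real"
    and T T' :: "'a \<Rightarrow> 'a"
    and y0 :: 'a
  assumes mu_prob: "prob_space \<mu>" and mu_sets: "sets \<mu> = sets borel"
    and nu_prob: "prob_space \<nu>" and nu_sets: "sets \<nu> = sets borel"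
    and mu_supp: "compact (msupport \<mu>)" and nu_supp: "compact (msupport \<nu>)"
    and mu_ac: "absolutely_continuous lborel \<mu>"
    and c_cont: "continuous_on UNIV (\<lambda>(x, y). c x y)"
    and c_nonneg: "\<forall>x y. c x y \<ge> 0"
    and c_i1: "\<forall>x. \<exists>!y. c x y = 0"
    and c_i2: "\<forall>y. (INF x. c x y) = 0"
    and c_ii: "\<forall>y. strictly_quasiconvex (\<lambda>z. c z y)"
    and c_iii: "\<forall>l>0. \<forall>y. C1_boundary {z. c z y \<le> l}"
    and c_iv: "\<forall>x y y' l n. l > 0 \<longrightarrow> c x y = l \<longrightarrow> c x y' = l \<longrightarrow>
                 outer_normal {z. c z y \<le> l} x n \<longrightarrow> outer_normal {z. c z y' \<le> l} x n \<longrightarrow> y = y'"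
    and atom: "emeasure \<nu> {y0} > 0"
    and T_meas: "T \<in> borel_measurable borel" and T_push: "distr \<mu> borel T = \<nu>"
    and T_opt: "linf_optimal c \<mu> \<nu> (distr \<mu> borel (\<lambda>x. (x, T x)))"
    and T_cm: "inf_c_cm_plan c (distr \<mu> borel (\<lambda>x. (x, T x)))"
    and T'_meas: "T' \<in> borel_measurable borel" and T'_push: "distr \<mu> borel T' = \<nu>"
    and T'_opt: "linf_optimal c \<mu> \<nu> (distr \<mu> borel (\<lambda>x. (x, T' x)))"
    and T'_cm: "inf_c_cm_plan c (distr \<mu> borel (\<lambda>x. (x, T' x)))"
  shows "emeasure \<mu> (T -` {y0} - T' -` {y0}) = 0"
proof (rule ccontr)
  interpret quasiconvex_cost c
    using c_cont c_nonneg c_i1 c_i2 c_ii c_iii c_iv by unfold_locales auto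
  interpret prob_space \<mu> by (rule mu_prob)
  have space: "space \<mu> = UNIV" using sets_eq_imp_space_eq[OF mu_sets] by simp
  have meas: "borel_measurable \<mu> = borel_measurable borel"
    by (rule measurable_cong_sets[OF mu_sets refl])
  note [measurable] = T_meas T'_meas
  assume A_pos: "emeasure \<mu> (T -` {y0} - T' -` {y0}) \<noteq> 0"
  obtain \<Gamma> where \<Gamma>: "inf_c_cyclically_monotone c \<Gamma>" "AE p in distr \<mu> borel (\<lambda>x. (x, T x)). p \<in> \<Gamma>"
    using T_cm unfolding inf_c_cm_plan_def by blast
  obtain \<Gamma>' where \<Gamma>': "inf_c_cyclically_monotone c \<Gamma>'" "AE p in distr \<mu> borel (\<lambda>x. (x, T' x)). p \<in> \<Gamma>'"
    using T'_cm unfolding inf_c_cm_plan_def by blast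
  have "AE x in \<mu>. (x, T x) \<in> \<Gamma>" "AE x in \<mu>. (x, T' x) \<in> \<Gamma>'"
    by (rule AE_distrD[OF _ \<Gamma>(2)] AE_distrD[OF _ \<Gamma>'(2)], simp add: meas)+
  then have "AE x in \<mu>. (x, T x) \<in> \<Gamma> \<and> (x, T' x) \<in> \<Gamma>'" by eventually_elim simp
  then obtain N where N: "N \<in> null_sets \<mu>" "{x \<in> space \<mu>. \<not> ((x, T x) \<in> \<Gamma> \<and> (x, T' x) \<in> \<Gamma>')} \<subseteq> N"
    unfolding eventually_ae_filter by blast
  \<comment> \<open>On \<open>G\<close> both graphs lie in their monotone sets pointwise, so each of
    its points may enter a cycle, also as a detour point.\<close>
  define G where "G = - N"
  have G: "G \<in> sets borel" using null_setsD2[OF N(1)] unfolding G_def mu_sets by (rule borel_comp)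
  have G\<Gamma>: "(x, T x) \<in> \<Gamma>" "(x, T' x) \<in> \<Gamma>'" if "x \<in> G" for x
    using N(2) that by (auto simp: G_def space)
  define K where "K n = {x \<in> G. norm (T x) \<le> real n \<and> norm (T' x) \<le> real n \<and>
       (x, T x, T' x) \<in> detour_gap T G n \<and> (x, T' x, T x) \<in> detour_gap T' G n}" for n
  define D where "D = {x. T x \<noteq> T' x}"
  have D_meas: "D \<in> sets \<mu>"
  proof -
    have "{x \<in> space borel. T x \<noteq> T' x} \<in> sets borel" by measurable
    then show ?thesis by (simp add: D_def mu_sets)
  qed
  have K_meas: "K n \<in> sets \<mu>" for n
  proof -
    note [measurable] = G borel_open[OF open_detour_gap[of T G n]] borel_open[OF open_detour_gap[of T' G n]]
    have "{x \<in> space borel. x \<in> G \<and> norm (T x) \<le> real n \<and> norm (T' x) \<le> real n \<and>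
       (x, T x, T' x) \<in> detour_gap T G n \<and> (x, T' x, T x) \<in> detour_gap T' G n} \<in> sets borel"
      by measurable
    then show ?thesis by (simp add: K_def mu_sets)
  qed
  have sets_eq: "sets \<mu> = sets lborel" by (simp add: mu_sets)
  \<comment> \<open>Absolute continuity carries the Lebesgue-a.e. detours over to
    \<open>\<mu>\<close>; almost every point where the maps differ therefore lies in some
    \<open>K n\<close>.\<close>
  have "AE x in \<mu>. \<not> x \<in> (\<Inter>n. D - K n)"
    using AE_not_in[OF N(1)]
      absolutely_continuous_AE[OF sets_eq mu_ac AE_cheaper_detour[OF G T_meas]]
      absolutely_continuous_AE[OF sets_eq mu_ac AE_cheaper_detour[OF G T'_meas]]
  proof (eventually_elim)
    case (elim x)
    show ?case
    proof
      assume x: "x \<in> (\<Inter>n. D - K n)"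
      then have ne: "T x \<noteq> T' x" by (auto simp: D_def)
      have "x \<in> G" using elim(1) by (simp add: G_def)
      obtain n1 where n1: "(x, T x, T' x) \<in> detour_gap T G n1"
        using elim(2) \<open>x \<in> G\<close> ne in_some_detour_gap by metis
      obtain n2 where n2: "(x, T' x, T x) \<in> detour_gap T' G n2"
        using elim(3) \<open>x \<in> G\<close> ne in_some_detour_gap by metis
      obtain n3 where n3: "norm (T x) \<le> real n3" using real_arch_simple by blast
      obtain n4 where n4: "norm (T' x) \<le> real n4" using real_arch_simple by blast
      define n where "n = Max {n1, n2, n3, n4}"
      have "n1 \<le> n" "n2 \<le> n" "n3 \<le> n" "n4 \<le> n" by (auto simp: n_def)
      then have "x \<in> K n"
        using \<open>x \<in> G\<close> n1 n2 n3 n4 detour_gap_mono[of n1 n T G] detour_gap_mono[of n2 n T' G]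
        by (auto simp: K_def)
      with x show False by blast
    qed
  qed
  then have "emeasure \<mu> (\<Inter>n. D - K n) = 0"
    using D_meas K_meas by (subst AE_iff_measurable[symmetric, where P = "\<lambda>x. x \<notin> (\<Inter>n. D - K n)"])
       (auto simp: space)
  \<comment> \<open>Continuity from above makes the mass of \<open>D - K n\<close> fall below that
    of the points which only \<open>T\<close> sends to \<open>y0\<close>.\<close>
  moreover have "decseq (\<lambda>n. D - K n)"
    unfolding decseq_def
  proof (intro allI impI Diff_mono order_refl)
    fix m n :: nat assume "m \<le> n"
    then show "K m \<subseteq> K n"
      using detour_gap_mono[of m n T G] detour_gap_mono[of m n T' G] by (auto simp: K_def)
  qed
  then have "(\<lambda>n. emeasure \<mu> (D - K n)) \<longlonglongrightarrow> emeasure \<mu> (\<Inter>n. D - K n)"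
    using D_meas K_meas by (intro Lim_emeasure_decseq) auto
  ultimately have "(\<lambda>n. emeasure \<mu> (D - K n)) \<longlonglongrightarrow> 0" by simp
  moreover have "0 < emeasure \<mu> (T -` {y0} - T' -` {y0})"
    using A_pos by (simp add: zero_less_iff_neq_zero)
  ultimately have "eventually (\<lambda>n. emeasure \<mu> (D - K n) < emeasure \<mu> (T -` {y0} - T' -` {y0})) sequentially"
    by (rule order_tendstoD(2))
  then obtain n where n: "emeasure \<mu> (D - K n) < emeasure \<mu> (T -` {y0} - T' -` {y0})"
    using eventually_happens'[OF sequentially_bot] by blast
  obtain \<epsilon> where \<epsilon>: "\<epsilon> > 0" and no_cycle:
    "\<And>(I :: nat set) \<pi> f. \<lbrakk>finite I; I \<noteq> {}; bij_betw \<pi> I I; \<And>i. i \<in> I \<Longrightarrow> f i \<in> K n;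
        \<And>i. i \<in> I \<Longrightarrow> dist (T' (f i)) (T (f (\<pi> i))) < \<epsilon>\<rbrakk> \<Longrightarrow> False"
    using monotone_maps_no_approximate_cycle[OF \<Gamma>(1) \<Gamma>'(1) G\<Gamma>, of G "K n" n] unfolding K_def by blast
  have A_eq: "T -` {y0} - T' -` {y0} = {x \<in> space \<mu>. T x = y0 \<and> T' x \<noteq> y0}"
    by (auto simp: space)
  show False
  proof (rule approximate_cycle_through_atom[of T T' D "K n" y0 \<epsilon>])
    show "distr \<mu> borel T = distr \<mu> borel T'" by (simp add: T_push T'_push)
    fix I :: "nat set" and \<pi> f
    assume "finite I" "I \<noteq> {}" "bij_betw \<pi> I I" "\<And>i. i \<in> I \<Longrightarrow> f i \<in> K n"
      "\<And>i. i \<in> I \<Longrightarrow> dist (T' (f i)) (T (f (\<pi> i))) < \<epsilon>"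
    then show False by (rule no_cycle)
  qed (use T_meas T'_meas meas K_meas n \<epsilon> in \<open>auto simp: A_eq D_def space\<close>)
qed

end
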